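(* Let $N\ge 2$ be fixed and let $(\theta_t)_{t\ge 0}$ be the ACCA dynamics on the ring with $N$ vertices (periodic boundary conditions), started from an arbitrary initial configuration $\theta_0\in[-\pi,\pi)^N$. Then \[ \lim_{t\to\infty}\ \max_{1\le i\le N}|\delta_t(i)|=0\qquad\text{almost surely}, \] and hence strong consensus holds almost surely.
   Context: For $a\in\mathbb R$ let $\operatorname{wrap}_\pi(a):=a-2\pi\lfloor\frac{a+\pi}{2\pi}\rfloor\in[-\pi,\pi)$. The circle $\mathbb S^1$ is identified with $[-\pi,\pi)$, i.e. with $\mathbb R/2\pi\mathbb Z$. The ring has vertex set $\{1,\dots,N\}$ and edges $(i,i+1)$, $1\le i\le N$, with indices read modulo $N$ (so $N+1\equiv 1$ and the last edge is $(N,1)$). A configuration is $\theta\in[-\pi,\pi)^N$, and $\delta_t(i):=\operatorname{wrap}_\pi(\theta_t(i+1)-\theta_t(i))$ for $1\le i\le N$. ACCA dynamics (discrete time Markov chain): at each step $t\to t+1$ an edge $(k,k+1)$ is chosen uniformly at random among all edges, independently of the past, and \[ \theta_{t+1}(k)=\operatorname{wrap}_\pi\big(\theta_t(k)+\tfrac12\delta_t(k)\big),\qquad \theta_{t+1}(k+1)=\operatorname{wrap}_\pi\big(\theta_t(k+1)-\tfrac12\delta_t(k)\big), \] while $\theta_{t+1}(i)=\theta_t(i)$ for $i\notin\{k,k+1\}$ (these two new values coincide: both are the midpoint along the shortest arc). If $\delta_t(k)=-\pi$ (antipodal case), the common new value at $k$ and $k+1$ is instead chosen, with probability $1/2$ each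 and independently, between the two midpoints $\operatorname{wrap}_\pi(\theta_t(k)+\tfrac{\pi}{2})$ and $\operatorname{wrap}_\pi(\theta_t(k)-\tfrac{\pi}{2})$. Strong consensus means: there is a random $L\in\mathbb S^1$ such that $\theta_t(v)\to L$ in $\mathbb S^1$ as $t\to\infty$ for all vertices $v$. *)

theory Defs
  imports "HOL-Probability.Probability"
begin

definition wrap_pi :: "real \<Rightarrow> real" where
  "wrap_pi a = a - 2 * pi * real_of_int \<lfloor>(a + pi) / (2 * pi)\<rfloor>"

(* The circle is {-pi..<pi}, standing for the reals modulo 2 pi; this is the quotient metric. *)
definition circle_dist :: "real \<Rightarrow> real \<Rightarrow> real" where
  "circle_dist a b = \<bar>wrap_pi (a - b)\<bar>"

definition circle_tendsto :: "(nat \<Rightarrow> real) \<Rightarrow> real \<Rightarrow> bool" where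
  "circle_tendsto x l \<longleftrightarrow> (\<lambda>t. circle_dist (x t) l) \<longlonglongrightarrow> 0"

(* Vertices are {1..N}. A configuration is a function of which only the values on {1..N}
   matter. The edge (k, k+1) is identified with its first endpoint k, so that for N = 2 the
   edges (1, 2) and (2, 1) are distinct. *)

type_synonym config = "nat \<Rightarrow> real"

definition ring_next :: "nat \<Rightarrow> nat \<Rightarrow> nat" where
  "ring_next N i = (if i = N then 1 else i + 1)"

definition edge_diff :: "nat \<Rightarrow> config \<Rightarrow> nat \<Rightarrow> real" where
  "edge_diff N \<theta> i = wrap_pi (\<theta> (ring_next N i) - \<theta> i)"

(* The coin b selects one of the two midpoints and is consulted only in the antipodal case. *)
definition acca_step :: "nat \<Rightarrow> nat \<times> bool \<Rightarrow> config \<Rightarrow> config" where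
  "acca_step N = (\<lambda>(k, b) \<theta>.
     if edge_diff N \<theta> k = - pi then
       let m = wrap_pi (if b then \<theta> k + pi / 2 else \<theta> k - pi / 2)
       in \<theta>(k := m, ring_next N k := m)
     else
       \<theta>(k := wrap_pi (\<theta> k + edge_diff N \<theta> k / 2),
         ring_next N k := wrap_pi (\<theta> (ring_next N k) - edge_diff N \<theta> k / 2)))"

(* Trajectory started at \<theta>0 in which step t -> t+1 uses the edge and coin xi t. *)
primrec acca :: "nat \<Rightarrow> config \<Rightarrow> (nat \<Rightarrow> nat \<times> bool) \<Rightarrow> nat \<Rightarrow> config" where
  "acca N \<theta>0 \<xi> 0 = \<theta>0"
| "acca N \<theta>0 \<xi> (Suc t) = acca_step N (\<xi> t) (acca N \<theta>0 \<xi> t)"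

(* The edges and coins of the ACCA dynamics: at each time a uniformly random edge and an
   independent fair coin, independent over time. Since the initial configuration is
   deterministic, this says that each step is independent of the past. *)
definition acca_noise :: "nat \<Rightarrow> 'w measure \<Rightarrow> (nat \<Rightarrow> 'w \<Rightarrow> nat \<times> bool) \<Rightarrow> bool" where
  "acca_noise N M \<xi> \<longleftrightarrow>
     prob_space M \<and>
     prob_space.indep_vars M (\<lambda>_. count_space UNIV) \<xi> UNIV \<and>
     (\<forall>t. distr M (count_space UNIV) (\<xi> t) =
          measure_pmf (pair_pmf (pmf_of_set {1..N}) (bernoulli_pmf (1 / 2))))"

(* Almost sure strong consensus; the limit L is a random variable with values in the circle. *)
definition strong_consensus_as ::
    "nat \<Rightarrow> 'w measure \<Rightarrow> (nat \<Rightarrow> 'w \<Rightarrow> config) \<Rightarrow> bool" where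
  "strong_consensus_as N M \<theta> \<longleftrightarrow>
     (\<exists>L. L \<in> borel_measurable M \<and> (\<forall>\<omega>\<in>space M. L \<omega> \<in> {-pi..<pi}) \<and>
        (AE \<omega> in M. \<forall>v\<in>{1..N}. circle_tendsto (\<lambda>t. \<theta> t \<omega> v) (L \<omega>)))"

end

theory Submission
  imports Defs
begin

text \<open>A step at edge \<open>k\<close> annihilates \<open>\<delta>(k)\<close> and adds \<open>\<plusminus>\<delta>(k)/2\<close>, up to wrapping, to the two
  neighbouring differences. Wrapping only decreases absolute values, so \<open>V = \<Sum>\<^sub>i \<bar>\<delta>(i)\<bar>\<close> never
  increases. Sweeping the edges \<open>1, \<dots>, N - 1\<close> in order contracts \<open>W = \<Sum>\<^sub>i\<^sub><\<^sub>N \<bar>\<delta>(i)\<bar>\<close> by the factor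
  \<open>1 - 2\<^sup>-\<^sup>(\<^sup>N\<^sup>-\<^sup>1\<^sup>)\<close>, whatever the configuration and the coins, because some of the mass leaks
  into edge \<open>N\<close>; and \<open>V \<le> 2 W\<close> by the triangle inequality. Almost surely, for every \<open>R\<close>, some
  stretch of the noise consists of \<open>R\<close> consecutive sweeps, hence \<open>V\<close> tends to 0 almost surely.
  Once \<open>V\<close> is small, all vertices are confined to a short arc, since short arcs are convex; so
  every trajectory is Cauchy in the circle.\<close>

section \<open>The circle\<close>

lemma wrap_pi_shift: "wrap_pi (a + 2 * pi * of_int n) = wrap_pi a"
proof -
  have "(a + 2 * pi * of_int n + pi) / (2 * pi) = (a + pi) / (2 * pi) + of_int n"
    by (simp add: field_simps)
  then show ?thesis by (simp add: wrap_pi_def algebra_simps)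
qed

lemma wrap_pi_cong:
  assumes "a = b + 2 * pi * of_int n"
  shows "wrap_pi a = wrap_pi b"
  using assms by (simp add: wrap_pi_shift)

lemma wrap_pi_decompose: obtains n :: int where "wrap_pi a = a + 2 * pi * of_int n"
  using that[of "- \<lfloor>(a + pi) / (2 * pi)\<rfloor>"] by (simp add: wrap_pi_def)

lemma wrap_pi_ge: "- pi \<le> wrap_pi a" and wrap_pi_less: "wrap_pi a < pi"
proof -
  let ?n = "real_of_int \<lfloor>(a + pi) / (2 * pi)\<rfloor>"
  have "?n \<le> (a + pi) / (2 * pi)" "(a + pi) / (2 * pi) < ?n + 1" by linarith+
  then have "?n * (2 * pi) \<le> a + pi" "a + pi < (?n + 1) * (2 * pi)"
    using pi_gt_zero by (simp_all only: pos_le_divide_eq pos_divide_less_eq mult_pos_pos zero_less_numeral)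
  then show "- pi \<le> wrap_pi a" "wrap_pi a < pi"
    by (simp_all add: wrap_pi_def algebra_simps)
qed

lemma wrap_pi_id:
  assumes "- pi \<le> a" "a < pi"
  shows "wrap_pi a = a"
proof -
  have "\<lfloor>(a + pi) / (2 * pi)\<rfloor> = 0"
    using assms by (simp add: floor_eq_iff)
  then show ?thesis by (simp add: wrap_pi_def)
qed

lemma abs_wrap_pi_le_pi: "\<bar>wrap_pi a\<bar> \<le> pi"
  using wrap_pi_ge[of a] wrap_pi_less[of a] by linarith

lemma abs_wrap_pi_le: "\<bar>wrap_pi a\<bar> \<le> \<bar>a\<bar>"
proof (cases "- pi \<le> a \<and> a < pi")
  case False
  then have "pi \<le> \<bar>a\<bar>" by linarith
  with abs_wrap_pi_le_pi[of a] show ?thesis by linarith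
qed (simp add: wrap_pi_id)

text \<open>Inner wrapping changes an argument by a multiple of \<open>2 * pi\<close> only. As simp
  rules these let differences on the circle be computed as if on the line.\<close>

lemma wrap_pi_wrap_pi [simp]:
  "wrap_pi (wrap_pi a) = wrap_pi a"
  "wrap_pi (wrap_pi a + b) = wrap_pi (a + b)"
  "wrap_pi (b + wrap_pi a) = wrap_pi (b + a)"
  "wrap_pi (wrap_pi a - b) = wrap_pi (a - b)"
  "wrap_pi (b - wrap_pi a) = wrap_pi (b - a)"
  "wrap_pi (- wrap_pi a) = wrap_pi (- a)"
proof -
  obtain n where n: "wrap_pi a = a + 2 * pi * of_int n" by (rule wrap_pi_decompose)
  show "wrap_pi (wrap_pi a) = wrap_pi a"
    "wrap_pi (wrap_pi a + b) = wrap_pi (a + b)"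
    "wrap_pi (b + wrap_pi a) = wrap_pi (b + a)"
    "wrap_pi (wrap_pi a - b) = wrap_pi (a - b)"
    by (rule wrap_pi_cong[where n = n]; simp add: n algebra_simps)+
  show "wrap_pi (b - wrap_pi a) = wrap_pi (b - a)"
    "wrap_pi (- wrap_pi a) = wrap_pi (- a)"
    by (rule wrap_pi_cong[where n = "- n"]; simp add: n algebra_simps)+
qed

text \<open>\<open>wrap_pi\<close> itself is not odd, because \<open>-pi\<close> and
  \<open>pi\<close> share the value \<open>-pi\<close>. Its absolute value is even since wrapping a
  representative never enlarges it.\<close>

lemma abs_wrap_pi_minus: "\<bar>wrap_pi (- a)\<bar> = \<bar>wrap_pi a\<bar>"
proof (rule antisym)
  show "\<bar>wrap_pi (- a)\<bar> \<le> \<bar>wrap_pi a\<bar>"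
    using abs_wrap_pi_le[of "- wrap_pi a"] by simp
  show "\<bar>wrap_pi a\<bar> \<le> \<bar>wrap_pi (- a)\<bar>"
    using abs_wrap_pi_le[of "- wrap_pi (- a)"] by simp
qed

lemma wrap_pi_borel_measurable [measurable]: "wrap_pi \<in> borel_measurable borel"
  unfolding wrap_pi_def by measurable

section \<open>The quotient metric on the circle\<close>

lemma circle_dist_nonneg [simp]: "0 \<le> circle_dist a b"
  by (simp add: circle_dist_def)

lemma circle_dist_self [simp]: "circle_dist a a = 0"
  by (simp add: circle_dist_def wrap_pi_id)

lemma circle_dist_commute: "circle_dist a b = circle_dist b a"
  using abs_wrap_pi_minus[of "b - a"] by (simp add: circle_dist_def)

lemma circle_dist_wrap_pi [simp]:
  "circle_dist (wrap_pi a) b = circle_dist a b"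
  "circle_dist a (wrap_pi b) = circle_dist a b"
  by (simp_all add: circle_dist_def)

lemma circle_dist_le_abs: "circle_dist a b \<le> \<bar>a - b\<bar>"
  by (simp add: circle_dist_def abs_wrap_pi_le)

lemma circle_dist_triangle: "circle_dist a c \<le> circle_dist a b + circle_dist b c"
proof -
  have "wrap_pi (a - c) = wrap_pi (wrap_pi (a - b) + wrap_pi (b - c))" by simp
  then have "circle_dist a c \<le> \<bar>wrap_pi (a - b) + wrap_pi (b - c)\<bar>"
    unfolding circle_dist_def using abs_wrap_pi_le by metis
  then show ?thesis unfolding circle_dist_def by linarith
qed

text \<open>The lift of a circle-valued sequence to the line along shortest arcs. It turns the limit
  on the circle into an explicit real limit, which is what later makes the consensus value
  measurable.\<close>

definition circle_lift :: "(nat \<Rightarrow> real) \<Rightarrow> nat \<Rightarrow> real" where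
  "circle_lift x t = x 0 + (\<Sum>s<t. wrap_pi (x (Suc s) - x s))"

lemma wrap_pi_circle_lift_diff:
  "wrap_pi (circle_lift x t - b) = wrap_pi (x t - b)"
  "wrap_pi (b - circle_lift x t) = wrap_pi (b - x t)"
proof -
  have *: "wrap_pi (circle_lift x t) = wrap_pi (x t)"
  proof (induction t)
    case (Suc t)
    have "wrap_pi (circle_lift x (Suc t))
        = wrap_pi (wrap_pi (circle_lift x t) + wrap_pi (x (Suc t) - x t))"
      by (simp add: circle_lift_def algebra_simps)
    also have "\<dots> = wrap_pi (x (Suc t))"
      unfolding Suc by simp
    finally show ?case .
  qed (simp add: circle_lift_def)
  show "wrap_pi (circle_lift x t - b) = wrap_pi (x t - b)"
    using * wrap_pi_wrap_pi(4) by metis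
  show "wrap_pi (b - circle_lift x t) = wrap_pi (b - x t)"
    using * wrap_pi_wrap_pi(5) by metis
qed

text \<open>A sequence that stays in an arc shorter than a half circle cannot wind around, so its
  lift is as concentrated as the sequence itself.\<close>

lemma circle_Cauchy_imp_tendsto:
  assumes Cauchy: "\<And>e. 0 < e \<Longrightarrow> \<exists>t0. \<forall>t\<ge>t0. circle_dist (x t) (x t0) \<le> e"
  shows "circle_tendsto x (wrap_pi (lim (circle_lift x)))"
proof -
  have "Cauchy (circle_lift x)"
  proof (rule metric_CauchyI)
    fix e :: real assume "0 < e"
    define r where "r = min (e / 3) 1"
    have r: "0 < r" "r < e / 2" "3 * r < pi"
      using \<open>0 < e\<close> pi_gt3 by (auto simp: r_def)
    obtain t0 where t0: "\<And>t. t0 \<le> t \<Longrightarrow> circle_dist (x t) (x t0) \<le> r"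
      using Cauchy[OF r(1)] by blast
    have near: "\<bar>circle_lift x t - circle_lift x t0\<bar> \<le> r" if "t0 \<le> t" for t
      using that
    proof (induction rule: dec_induct)
      case (step t)
      have "circle_dist (x (Suc t)) (x t) \<le> 2 * r"
        using circle_dist_triangle[of "x (Suc t)" "x t" "x t0"] t0[of t] t0[of "Suc t"] step
        by (simp add: circle_dist_commute)
      then have "\<bar>circle_lift x (Suc t) - circle_lift x t\<bar> \<le> 2 * r"
        by (simp add: circle_lift_def circle_dist_def)
      \<comment> \<open>One increment cannot leave \<open>3 * r < pi\<close>, so the wrapping is
        trivial here; the hypothesis on the circle then improves \<open>3 * r\<close> back to
        \<open>r\<close> and closes the induction.\<close>
      with step.IH have "\<bar>circle_lift x (Suc t) - circle_lift x t0\<bar> \<le> 3 * r" by linarith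
      with r have "wrap_pi (circle_lift x (Suc t) - circle_lift x t0)
          = circle_lift x (Suc t) - circle_lift x t0"
        by (intro wrap_pi_id) linarith+
      moreover have "\<bar>wrap_pi (circle_lift x (Suc t) - circle_lift x t0)\<bar> \<le> r"
        using t0[of "Suc t"] step by (simp add: wrap_pi_circle_lift_diff circle_dist_def)
      ultimately show ?case by simp
    qed (use r in simp)
    show "\<exists>K. \<forall>m\<ge>K. \<forall>n\<ge>K. dist (circle_lift x m) (circle_lift x n) < e"
    proof (intro exI allI impI)
      fix m n assume "t0 \<le> m" "t0 \<le> n"
      then show "dist (circle_lift x m) (circle_lift x n) < e"
        using near[of m] near[of n] r(2) unfolding dist_real_def by linarith
    qed
  qed
  then have "circle_lift x \<longlonglongrightarrow> lim (circle_lift x)"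
    using Cauchy_convergent convergent_LIMSEQ_iff by blast
  then have "(\<lambda>t. \<bar>circle_lift x t - lim (circle_lift x)\<bar>) \<longlonglongrightarrow> 0"
    by (intro tendsto_rabs_zero) (simp add: LIM_zero_iff)
  then show ?thesis
    unfolding circle_tendsto_def
  proof (rule tendsto_sandwich[OF _ _ tendsto_const, rotated 2])
    have "circle_dist (x t) (lim (circle_lift x)) \<le> \<bar>circle_lift x t - lim (circle_lift x)\<bar>" for t
      using abs_wrap_pi_le[of "circle_lift x t - lim (circle_lift x)"]
      by (simp add: circle_dist_def wrap_pi_circle_lift_diff)
    then show "\<forall>\<^sub>F t in sequentially. circle_dist (x t) (wrap_pi (lim (circle_lift x)))
        \<le> \<bar>circle_lift x t - lim (circle_lift x)\<bar>"
      by simp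
  qed simp
qed

section \<open>One step of the dynamics\<close>

lemma ring_next_mem: "i \<in> {1..N} \<Longrightarrow> ring_next N i \<in> {1..N}"
  by (auto simp: ring_next_def)

lemma ring_next_neq: "2 \<le> N \<Longrightarrow> ring_next N i \<noteq> i"
  by (auto simp: ring_next_def)

lemma inj_on_ring_next: "inj_on (ring_next N) {1..N}"
  by (auto simp: inj_on_def ring_next_def split: if_splits)

lemma ring_prev_exists:
  assumes "k \<in> {1..N}"
  obtains j where "j \<in> {1..N}" "ring_next N j = k"
proof (cases "k = 1")
  case True
  then show ?thesis using assms that[of N] by (simp add: ring_next_def)
next
  case False
  then have "k - 1 \<in> {1..N}" "ring_next N (k - 1) = k"
    using assms by (auto simp: ring_next_def)
  then show ?thesis by (rule that)
qed

lemma abs_edge_diff: "\<bar>edge_diff N \<theta> i\<bar> = circle_dist (\<theta> (ring_next N i)) (\<theta> i)"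
  by (simp add: edge_diff_def circle_dist_def)

lemma edge_diff_decompose:
  obtains n :: int where "\<theta> (ring_next N k) = \<theta> k + edge_diff N \<theta> k + 2 * pi * of_int n"
proof -
  obtain n where "edge_diff N \<theta> k = \<theta> (ring_next N k) - \<theta> k + 2 * pi * of_int n"
    unfolding edge_diff_def by (rule wrap_pi_decompose)
  then show ?thesis using that[of "- n"] by simp
qed

lemma acca_step_other:
  "v \<noteq> k \<Longrightarrow> v \<noteq> ring_next N k \<Longrightarrow> acca_step N (k, b) \<theta> v = \<theta> v"
  by (simp add: acca_step_def Let_def)

lemma acca_step_merge:
  assumes "2 \<le> N"
  shows "acca_step N (k, b) \<theta> (ring_next N k) = acca_step N (k, b) \<theta> k"
proof -
  obtain n where n: "\<theta> (ring_next N k) = \<theta> k + edge_diff N \<theta> k + 2 * pi * of_int n"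
    by (rule edge_diff_decompose)
  have "wrap_pi (\<theta> (ring_next N k) - edge_diff N \<theta> k / 2) = wrap_pi (\<theta> k + edge_diff N \<theta> k / 2)"
    by (rule wrap_pi_cong[where n = n]) (simp add: n)
  then show ?thesis
    using ring_next_neq[OF assms, of k] by (auto simp: acca_step_def Let_def)
qed

text \<open>Both midpoints of an antipodal pair lie at distance \<open>pi / 2\<close> from both
  endpoints, so the bound holds whatever the coin shows.\<close>

lemma acca_step_displacement:
  assumes "2 \<le> N"
  shows "circle_dist (acca_step N (k, b) \<theta> v) (\<theta> v)
     \<le> (if v = k \<or> v = ring_next N k then \<bar>edge_diff N \<theta> k\<bar> / 2 else 0)"
proof (cases "v = k \<or> v = ring_next N k")
  case False
  then show ?thesis by (simp add: acca_step_other)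
next
  case v: True
  obtain n where n: "\<theta> (ring_next N k) = \<theta> k + edge_diff N \<theta> k + 2 * pi * of_int n"
    by (rule edge_diff_decompose)
  define s :: real where "s = (if b then 1 else - 1)"
  have s: "\<bar>s\<bar> = 1" "s = 1 \<or> s = -1" by (auto simp: s_def)
  show ?thesis
  proof (cases "edge_diff N \<theta> k = - pi")
    case True
    have step: "acca_step N (k, b) \<theta> v = wrap_pi (\<theta> k + s * pi / 2)"
      using v True by (auto simp: acca_step_def Let_def s_def)
    show ?thesis
    proof (cases "v = k")
      case True
      have "circle_dist (\<theta> k + s * pi / 2) (\<theta> v) \<le> pi / 2"
        using circle_dist_le_abs[of "\<theta> k + s * pi / 2" "\<theta> v"] s True by auto
      then show ?thesis
        using v \<open>edge_diff N \<theta> k = - pi\<close> unfolding step by simp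
    next
      case False
      with v have "v = ring_next N k" by simp
      \<comment> \<open>Here \<open>\<theta> v = \<theta> k - pi + 2 * pi * n\<close>, and adding
        \<open>pi\<close> to \<open>s * pi / 2\<close> gives \<open>- s * pi / 2\<close> up to one
        full turn if \<open>s = 1\<close> and exactly if \<open>s = -1\<close>.\<close>
      define m where "m = (if s = 1 then 1 - n else - n)"
      have "wrap_pi (\<theta> k + s * pi / 2 - \<theta> v) = wrap_pi (- s * pi / 2)"
        by (rule wrap_pi_cong[where n = m])
          (use s(2) in \<open>auto simp: n \<open>v = ring_next N k\<close> True m_def field_simps\<close>)
      then have "circle_dist (\<theta> k + s * pi / 2) (\<theta> v) \<le> \<bar>- s * pi / 2\<bar>"
        unfolding circle_dist_def using abs_wrap_pi_le by metis
      then show ?thesis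
        using v s True by (auto simp: step)
    qed
  next
    case False
    have "acca_step N (k, b) \<theta> v = wrap_pi (\<theta> v + edge_diff N \<theta> k / 2)
      \<or> acca_step N (k, b) \<theta> v = wrap_pi (\<theta> v - edge_diff N \<theta> k / 2)"
      using v False by (auto simp: acca_step_def)
    then show ?thesis
      using v circle_dist_le_abs[of "\<theta> v + edge_diff N \<theta> k / 2" "\<theta> v"]
        circle_dist_le_abs[of "\<theta> v - edge_diff N \<theta> k / 2" "\<theta> v"]
      by auto
  qed
qed

text \<open>The merged edge vanishes; any other edge changes by at most the displacement of its
  endpoints. The two neighbour terms are kept apart because for \<open>N = 2\<close> both apply to
  the same edge.\<close>

lemma abs_edge_diff_acca_step_le:
  assumes "2 \<le> N" "k \<in> {1..N}" "i \<in> {1..N}"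
  shows "\<bar>edge_diff N (acca_step N (k, b) \<theta>) i\<bar>
     \<le> (if i = k then 0 else \<bar>edge_diff N \<theta> i\<bar>)
       + (if ring_next N i = k then \<bar>edge_diff N \<theta> k\<bar> / 2 else 0)
       + (if i = ring_next N k then \<bar>edge_diff N \<theta> k\<bar> / 2 else 0)"
proof (cases "i = k")
  case True
  then show ?thesis by (simp add: abs_edge_diff acca_step_merge[OF assms(1)])
next
  case False
  let ?\<theta>' = "acca_step N (k, b) \<theta>"
  have "ring_next N i \<noteq> ring_next N k"
    using False assms inj_onD[OF inj_on_ring_next] by metis
  then have "circle_dist (?\<theta>' (ring_next N i)) (\<theta> (ring_next N i))
      \<le> (if ring_next N i = k then \<bar>edge_diff N \<theta> k\<bar> / 2 else 0)"
    using acca_step_displacement[OF assms(1), of k b \<theta> "ring_next N i"] by simp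
  moreover have "circle_dist (?\<theta>' i) (\<theta> i)
      \<le> (if i = ring_next N k then \<bar>edge_diff N \<theta> k\<bar> / 2 else 0)"
    using acca_step_displacement[OF assms(1), of k b \<theta> i] False by simp
  moreover have "circle_dist (?\<theta>' (ring_next N i)) (?\<theta>' i)
      \<le> circle_dist (?\<theta>' (ring_next N i)) (\<theta> (ring_next N i))
        + circle_dist (\<theta> (ring_next N i)) (\<theta> i) + circle_dist (?\<theta>' i) (\<theta> i)"
    using circle_dist_triangle[of "?\<theta>' (ring_next N i)" "?\<theta>' i" "\<theta> (ring_next N i)"]
      circle_dist_triangle[of "\<theta> (ring_next N i)" "?\<theta>' i" "\<theta> i"]
    by (simp add: circle_dist_commute)
  ultimately show ?thesis
    unfolding abs_edge_diff if_not_P[OF False] by linarith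
qed

section \<open>Weighted sums of edge differences and their one-step bounds\<close>

definition weighted_energy :: "nat \<Rightarrow> (nat \<Rightarrow> real) \<Rightarrow> config \<Rightarrow> real" where
  "weighted_energy N c \<theta> = (\<Sum>i\<in>{1..N}. c i * \<bar>edge_diff N \<theta> i\<bar>)"

abbreviation energy :: "nat \<Rightarrow> config \<Rightarrow> real" where
  "energy N \<equiv> weighted_energy N (\<lambda>_. 1)"

lemma weighted_energy_nonneg: "(\<And>i. 0 \<le> c i) \<Longrightarrow> 0 \<le> weighted_energy N c \<theta>"
  unfolding weighted_energy_def by (intro sum_nonneg) simp

lemma weighted_energy_mono:
  "(\<And>i. i \<in> {1..N} \<Longrightarrow> c i \<le> d i) \<Longrightarrow> weighted_energy N c \<theta> \<le> weighted_energy N d \<theta>"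
  unfolding weighted_energy_def by (intro sum_mono mult_right_mono) simp_all

lemma abs_edge_diff_le_energy:
  assumes "i \<in> {1..N}"
  shows "\<bar>edge_diff N \<theta> i\<bar> \<le> energy N \<theta>"
  using member_le_sum[of i "{1..N}" "\<lambda>i. \<bar>edge_diff N \<theta> i\<bar>"] assms
  by (simp add: weighted_energy_def)

text \<open>The dual view of mass transport: instead of following mass forward, the weights are
  pulled back through the step. As edge \<open>k\<close> gives half its mass to each neighbour, its
  weight becomes the mean of theirs.\<close>

lemma weighted_energy_acca_step_le:
  assumes N: "2 \<le> N" and j: "j \<in> {1..N}" and c: "\<And>i. 0 \<le> c i"
    and k: "k = ring_next N j" and l: "l = ring_next N k"
  shows "weighted_energy N c (acca_step N (k, b) \<theta>)
     \<le> weighted_energy N (c(k := (c j + c l) / 2)) \<theta>"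
proof -
  let ?a = "\<lambda>i. \<bar>edge_diff N \<theta> i\<bar>"
  have mem: "k \<in> {1..N}" "l \<in> {1..N}" using j k l by (simp_all only: ring_next_mem)
  have prev: "ring_next N i = k \<longleftrightarrow> i = j" if "i \<in> {1..N}" for i
    using that j k inj_onD[OF inj_on_ring_next] by metis
  have "weighted_energy N c (acca_step N (k, b) \<theta>)
     \<le> (\<Sum>i\<in>{1..N}. c i * ((if i = k then 0 else ?a i)
         + (if ring_next N i = k then ?a k / 2 else 0) + (if i = l then ?a k / 2 else 0)))"
    unfolding weighted_energy_def l
    by (intro sum_mono mult_left_mono abs_edge_diff_acca_step_le N mem c)
  also have "\<dots> = (\<Sum>i\<in>{1..N}. (if i = k then 0 else c i * ?a i)
         + (if i = j then c j * ?a k / 2 else 0) + (if i = l then c l * ?a k / 2 else 0))"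
    by (intro sum.cong refl) (auto simp: prev algebra_simps)
  also have "\<dots> = (\<Sum>i\<in>{1..N}. if i = k then 0 else c i * ?a i) + (c j + c l) / 2 * ?a k"
    using j mem by (simp add: sum.distrib algebra_simps add_divide_distrib)
  also have "\<dots> = (\<Sum>i\<in>{1..N}. (if i = k then 0 else c i * ?a i)
                   + (if i = k then (c j + c l) / 2 * ?a k else 0))"
    using mem by (simp add: sum.distrib)
  also have "\<dots> = weighted_energy N (c(k := (c j + c l) / 2)) \<theta>"
    unfolding weighted_energy_def by (intro sum.cong) auto
  finally show ?thesis .
qed

text \<open>Constant weights are fixed by the averaging of neighbours.\<close>

lemma energy_acca_step_le:
  assumes "2 \<le> N" "fst e \<in> {1..N}"
  shows "energy N (acca_step N e \<theta>) \<le> energy N \<theta>"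
proof -
  obtain k b where e: "e = (k, b)" by fastforce
  obtain j where "j \<in> {1..N}" "ring_next N j = k"
    using assms(2) e ring_prev_exists by auto
  then show ?thesis
    using weighted_energy_acca_step_le[OF assms(1), of j "\<lambda>_. 1" k] e by (simp add: fun_upd_idem)
qed

text \<open>The triangle inequality along the path \<open>1, ..., m\<close>, which avoids edge
  \<open>N\<close>. It serves both to bound edge \<open>N\<close> by the others and to place all
  vertices near vertex 1.\<close>

lemma circle_dist_le_sum_edge_diff:
  assumes "m \<in> {1..N}"
  shows "circle_dist (\<theta> m) (\<theta> 1) \<le> (\<Sum>i\<in>{1..<m}. \<bar>edge_diff N \<theta> i\<bar>)"
proof -
  have "1 \<le> m" using assms by simp
  \<comment> \<open>The upper bound is part of the induction formula because edge \<open>m\<close>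
    joins \<open>m\<close> to \<open>Suc m\<close> only below \<open>N\<close>.\<close>
  then have "m \<le> N \<longrightarrow> ?thesis"
  proof (induction rule: dec_induct)
    case (step m)
    show ?case
    proof
      assume "Suc m \<le> N"
      then have "\<bar>edge_diff N \<theta> m\<bar> = circle_dist (\<theta> (Suc m)) (\<theta> m)"
        by (simp add: abs_edge_diff ring_next_def)
      then show "circle_dist (\<theta> (Suc m)) (\<theta> 1) \<le> (\<Sum>i\<in>{1..<Suc m}. \<bar>edge_diff N \<theta> i\<bar>)"
        using step \<open>Suc m \<le> N\<close> circle_dist_triangle[of "\<theta> (Suc m)" "\<theta> 1" "\<theta> m"] by simp
    qed
  qed simp
  then show ?thesis using assms by simp
qed

lemma circle_dist_le_energy:
  assumes "m \<in> {1..N}"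
  shows "circle_dist (\<theta> m) (\<theta> 1) \<le> energy N \<theta>"
proof -
  have "(\<Sum>i\<in>{1..<m}. \<bar>edge_diff N \<theta> i\<bar>) \<le> energy N \<theta>"
    unfolding weighted_energy_def using assms by (simp, intro sum_mono2) auto
  with circle_dist_le_sum_edge_diff[OF assms, of \<theta>] show ?thesis by linarith
qed

section \<open>Contraction along a sweep\<close>

text \<open>Think of \<open>\<bar>edge_diff N \<theta> i\<bar>\<close> as mass at edge \<open>i\<close>; a step at \<open>i\<close> sends half of it to
  each neighbour, and mass arriving at edge \<open>N\<close> is discarded. If the edges
  \<open>Suc k, \<dots>, N - 1\<close> are still to be swept, \<open>sweep_weight N k i\<close> is a bound for the fraction of
  the mass at \<open>i\<close> that survives the sweep.\<close>

definition sweep_weight :: "nat \<Rightarrow> nat \<Rightarrow> nat \<Rightarrow> real" where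
  "sweep_weight N k i = (if i \<le> k then 1 else 1 - (1 / 2) ^ (N - i))"

lemma sweep_weight_nonneg: "0 \<le> sweep_weight N k i"
  by (simp add: sweep_weight_def power_le_one)

lemma sweep_weight_le_one: "sweep_weight N k i \<le> 1"
  by (simp add: sweep_weight_def)

abbreviation path_energy :: "nat \<Rightarrow> config \<Rightarrow> real" where
  "path_energy N \<equiv> weighted_energy N (sweep_weight N (N - 1))"

lemma path_energy_eq:
  assumes "2 \<le> N"
  shows "path_energy N \<theta> = (\<Sum>i\<in>{1..<N}. \<bar>edge_diff N \<theta> i\<bar>)"
proof -
  have "{1..N} = insert N {1..<N}" using assms by auto
  then have "path_energy N \<theta> = (\<Sum>i\<in>{1..<N}. sweep_weight N (N - 1) i * \<bar>edge_diff N \<theta> i\<bar>)"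
    using assms by (simp add: weighted_energy_def sweep_weight_def)
  also have "\<dots> = (\<Sum>i\<in>{1..<N}. \<bar>edge_diff N \<theta> i\<bar>)"
    by (intro sum.cong) (auto simp: sweep_weight_def)
  finally show ?thesis .
qed

lemma energy_le_path_energy:
  assumes "2 \<le> N"
  shows "energy N \<theta> \<le> 2 * path_energy N \<theta>"
proof -
  have "{1..N} = insert N {1..<N}" using assms by auto
  moreover have "\<bar>edge_diff N \<theta> N\<bar> \<le> path_energy N \<theta>"
    using circle_dist_le_sum_edge_diff[of N N \<theta>] assms
    unfolding path_energy_eq[OF assms]
    by (simp add: abs_edge_diff[of N \<theta> N] ring_next_def circle_dist_commute[of "\<theta> (Suc 0)"])
  ultimately show ?thesis
    unfolding path_energy_eq[OF assms] by (simp add: weighted_energy_def)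
qed

text \<open>Stepping at edge \<open>Suc k\<close> pulls the weights for the remaining sweep back to
  those that still include this edge; only the weight at \<open>Suc k\<close> differs.\<close>

lemma sweep_step:
  assumes "2 \<le> N" "Suc k < N" "fst e = Suc k"
  shows "weighted_energy N (sweep_weight N (Suc k)) (acca_step N e \<theta>)
     \<le> weighted_energy N (sweep_weight N k) \<theta>"
proof -
  obtain b where e: "e = (Suc k, b)" using assms(3) by (cases e) auto
  obtain j where j: "j \<in> {1..N}" "ring_next N j = Suc k"
    using ring_prev_exists[of "Suc k" N] assms(2) by auto
  let ?c = "sweep_weight N (Suc k)"
  have "weighted_energy N ?c (acca_step N e \<theta>)
      \<le> weighted_energy N (?c(Suc k := (?c j + ?c (Suc (Suc k))) / 2)) \<theta>"
    unfolding e using assms(2) j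
    by (intro weighted_energy_acca_step_le assms(1) sweep_weight_nonneg)
      (auto simp: ring_next_def)
  also have "\<dots> \<le> weighted_energy N (sweep_weight N k) \<theta>"
  proof (rule weighted_energy_mono)
    fix i assume "i \<in> {1..N}"
    \<comment> \<open>Mass sent back counts fully, mass sent forward with
      \<open>1 - (1/2) ^ (N - Suc (Suc k))\<close>; the mean of the two bounds is
      \<open>1 - (1/2) ^ (N - Suc k)\<close>. For \<open>Suc (Suc k) = N\<close> the forward weight
      is 0, which is the leak.\<close>
    have "N - Suc k = Suc (N - Suc (Suc k))" using assms(2) by simp
    then have "(?c j + ?c (Suc (Suc k))) / 2 \<le> sweep_weight N k (Suc k)"
      using sweep_weight_le_one[of N "Suc k" j] by (simp add: sweep_weight_def)
    then show "(?c(Suc k := (?c j + ?c (Suc (Suc k))) / 2)) i \<le> sweep_weight N k i"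
      by (auto simp: sweep_weight_def)
  qed
  finally show ?thesis .
qed

lemma sweep_contraction:
  assumes "2 \<le> N" and sweep: "\<And>k. Suc k < N \<Longrightarrow> fst (\<xi> (t + k)) = Suc k"
  shows "path_energy N (acca N \<theta>0 \<xi> (t + (N - 1)))
     \<le> (1 - (1 / 2) ^ (N - 1)) * path_energy N (acca N \<theta>0 \<xi> t)"
proof -
  let ?q = "1 - (1 / 2 :: real) ^ (N - 1)"
  have "weighted_energy N (sweep_weight N k) (acca N \<theta>0 \<xi> (t + k))
      \<le> weighted_energy N (sweep_weight N 0) (acca N \<theta>0 \<xi> t)" if "k < N" for k
    using that
  proof (induction k)
    case (Suc k)
    then show ?case
      using sweep_step[OF assms(1) Suc.prems sweep[OF Suc.prems], of "acca N \<theta>0 \<xi> (t + k)"]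
      by simp
  qed simp
  from this[of "N - 1"] have "path_energy N (acca N \<theta>0 \<xi> (t + (N - 1)))
      \<le> weighted_energy N (sweep_weight N 0) (acca N \<theta>0 \<xi> t)"
    using assms(1) by simp
  also have "\<dots> \<le> weighted_energy N (\<lambda>i. ?q * sweep_weight N (N - 1) i) (acca N \<theta>0 \<xi> t)"
  proof (rule weighted_energy_mono)
    fix i assume "i \<in> {1..N}"
    \<comment> \<open>Edge 1 is farthest from the leak and has the largest surviving fraction, so it
      determines the contraction factor.\<close>
    then have "(1 / 2 :: real) ^ (N - 1) \<le> (1 / 2) ^ (N - i)"
      by (intro power_decreasing) auto
    with \<open>i \<in> {1..N}\<close> show "sweep_weight N 0 i \<le> ?q * sweep_weight N (N - 1) i"
      by (auto simp: sweep_weight_def)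
  qed
  also have "\<dots> = ?q * path_energy N (acca N \<theta>0 \<xi> t)"
    by (simp add: weighted_energy_def sum_distrib_left mult.assoc)
  finally show ?thesis .
qed

lemma sweeps_contraction:
  assumes "2 \<le> N"
    and sweep: "\<And>j. j < R * (N - 1) \<Longrightarrow> fst (\<xi> (t + j)) = Suc (j mod (N - 1))"
  shows "path_energy N (acca N \<theta>0 \<xi> (t + R * (N - 1)))
     \<le> (1 - (1 / 2) ^ (N - 1)) ^ R * path_energy N (acca N \<theta>0 \<xi> t)"
  using sweep
proof (induction R)
  case (Suc R)
  let ?q = "1 - (1 / 2 :: real) ^ (N - 1)"
  have "path_energy N (acca N \<theta>0 \<xi> (t + R * (N - 1) + (N - 1)))
      \<le> ?q * path_energy N (acca N \<theta>0 \<xi> (t + R * (N - 1)))"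
  proof (rule sweep_contraction[OF assms(1)])
    fix k assume "Suc k < N"
    then show "fst (\<xi> (t + R * (N - 1) + k)) = Suc k"
      using Suc.prems[of "R * (N - 1) + k"] by (simp add: add.assoc)
  qed
  also have "\<dots> \<le> ?q * (?q ^ R * path_energy N (acca N \<theta>0 \<xi> t))"
    using Suc by (intro mult_left_mono) (auto simp: power_le_one)
  finally show ?case by (simp add: ac_simps)
qed simp

section \<open>Consensus along a fixed trajectory\<close>

lemma energy_acca_antimono:
  assumes "2 \<le> N" "\<And>t. fst (\<xi> t) \<in> {1..N}" "s \<le> t"
  shows "energy N (acca N \<theta>0 \<xi> t) \<le> energy N (acca N \<theta>0 \<xi> s)"
proof (rule lift_Suc_antimono_le[OF _ assms(3)])
  show "energy N (acca N \<theta>0 \<xi> (Suc n)) \<le> energy N (acca N \<theta>0 \<xi> n)" for n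
    using energy_acca_step_le[OF assms(1) assms(2)[of n]] by simp
qed

text \<open>One stretch of \<open>R\<close> sweeps for each \<open>R\<close> suffices, however late
  it occurs: the energy at its start is at most the initial one, and smallness at its end persists
  by monotonicity.\<close>

lemma energy_acca_tendsto_zero:
  assumes N: "2 \<le> N" and \<xi>: "\<And>t. fst (\<xi> t) \<in> {1..N}"
    and sweeps: "\<And>R. \<exists>t. \<forall>j<R * (N - 1). fst (\<xi> (t + j)) = Suc (j mod (N - 1))"
  shows "(\<lambda>t. energy N (acca N \<theta>0 \<xi> t)) \<longlonglongrightarrow> 0"
proof (rule LIMSEQ_I)
  fix e :: real assume "0 < e"
  let ?q = "1 - (1 / 2 :: real) ^ (N - 1)"
  let ?E = "energy N \<theta>0"
  have E: "0 \<le> ?E" by (rule weighted_energy_nonneg) simp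
  have "0 \<le> ?q" "?q < 1" by (simp_all add: power_le_one)
  \<comment> \<open>The 2 pays for passing from \<open>path_energy\<close> to \<open>energy\<close>;
    the 1 keeps the denominator positive when the initial energy is 0.\<close>
  then obtain R where R: "?q ^ R < e / (2 * (?E + 1))"
    using real_arch_pow_inv[of "e / (2 * (?E + 1))" ?q] \<open>0 < e\<close> E by auto
  obtain t where t: "\<And>j. j < R * (N - 1) \<Longrightarrow> fst (\<xi> (t + j)) = Suc (j mod (N - 1))"
    using sweeps by blast
  let ?t = "t + R * (N - 1)"
  have "energy N (acca N \<theta>0 \<xi> ?t) \<le> 2 * path_energy N (acca N \<theta>0 \<xi> ?t)"
    by (rule energy_le_path_energy[OF N])
  also have "\<dots> \<le> 2 * (?q ^ R * path_energy N (acca N \<theta>0 \<xi> t))"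
    using sweeps_contraction[OF N t] by simp
  also have "\<dots> \<le> 2 * (?q ^ R * (?E + 1))"
  proof -
    have "path_energy N (acca N \<theta>0 \<xi> t) \<le> energy N (acca N \<theta>0 \<xi> t)"
      by (intro weighted_energy_mono sweep_weight_le_one)
    also have "\<dots> \<le> ?E"
      using energy_acca_antimono[OF N \<xi>, of 0 t] by simp
    finally show ?thesis
      using \<open>0 \<le> ?q\<close> by (intro mult_left_mono) auto
  qed
  also have "\<dots> < e"
    using R E by (simp add: field_simps)
  finally have small: "energy N (acca N \<theta>0 \<xi> ?t) < e" .
  show "\<exists>T. \<forall>t\<ge>T. norm (energy N (acca N \<theta>0 \<xi> t) - 0) < e"
  proof (intro exI allI impI)
    fix s assume "?t \<le> s"
    then show "norm (energy N (acca N \<theta>0 \<xi> s) - 0) < e"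
      using energy_acca_antimono[of N \<xi> ?t s \<theta>0, OF N \<xi> \<open>?t \<le> s\<close>] small
        weighted_energy_nonneg[of "\<lambda>_. 1" N "acca N \<theta>0 \<xi> s"] by simp
  qed
qed

text \<open>Arcs shorter than a half circle are geodesically convex.\<close>

lemma acca_step_circle_dist_le:
  assumes "2 \<le> N" "k \<in> {1..N}" "r < pi / 2"
    and ball: "\<And>v. v \<in> {1..N} \<Longrightarrow> circle_dist (\<theta> v) c \<le> r" and "v \<in> {1..N}"
  shows "circle_dist (acca_step N (k, b) \<theta> v) c \<le> r"
proof (cases "v = k \<or> v = ring_next N k")
  case False
  then show ?thesis using ball[OF assms(5)] by (simp add: acca_step_other)
next
  case True
  let ?l = "ring_next N k"
  \<comment> \<open>In coordinates centred at \<open>c\<close> both endpoints lie within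
    \<open>r < pi / 2\<close> of 0, so their difference needs no wrapping, the antipodal case is
    excluded and the midpoint is the ordinary mean.\<close>
  define \<alpha> where "\<alpha> = wrap_pi (\<theta> k - c)"
  define \<beta> where "\<beta> = wrap_pi (\<theta> ?l - c)"
  have \<alpha>\<beta>: "\<bar>\<alpha>\<bar> \<le> r" "\<bar>\<beta>\<bar> \<le> r"
    using ball[OF assms(2)] ball[OF ring_next_mem[OF assms(2)]]
    by (simp_all add: \<alpha>_def \<beta>_def circle_dist_def)
  have "edge_diff N \<theta> k = wrap_pi (\<beta> - \<alpha>)"
    by (simp add: edge_diff_def \<alpha>_def \<beta>_def)
  also have "\<dots> = \<beta> - \<alpha>"
    using \<alpha>\<beta> assms(3) by (intro wrap_pi_id) linarith+
  finally have \<delta>: "edge_diff N \<theta> k = \<beta> - \<alpha>" .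
  then have "edge_diff N \<theta> k \<noteq> - pi" using \<alpha>\<beta> assms(3) by linarith
  then have "acca_step N (k, b) \<theta> k = wrap_pi (\<theta> k + edge_diff N \<theta> k / 2)"
    using ring_next_neq[OF assms(1), of k] by (simp add: acca_step_def)
  then have step: "acca_step N (k, b) \<theta> v = wrap_pi (\<theta> k + (\<beta> - \<alpha>) / 2)"
    using True acca_step_merge[OF assms(1)] \<delta> by auto
  have "wrap_pi (\<theta> k + (\<beta> - \<alpha>) / 2 - c) = wrap_pi (\<alpha> + (\<beta> - \<alpha>) / 2)"
    by (simp add: \<alpha>_def algebra_simps)
  also have "\<alpha> + (\<beta> - \<alpha>) / 2 = (\<alpha> + \<beta>) / 2" by (simp add: field_simps)
  finally have "circle_dist (acca_step N (k, b) \<theta> v) c \<le> \<bar>(\<alpha> + \<beta>) / 2\<bar>"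
    using abs_wrap_pi_le[of "(\<alpha> + \<beta>) / 2"] by (simp add: step circle_dist_def)
  also have "\<dots> \<le> r" using \<alpha>\<beta> by (simp add: abs_le_iff)
  finally show ?thesis .
qed

lemma acca_circle_dist_le:
  assumes "2 \<le> N" "\<And>t. fst (\<xi> t) \<in> {1..N}" "r < pi / 2"
    and ball: "\<And>v. v \<in> {1..N} \<Longrightarrow> circle_dist (acca N \<theta>0 \<xi> t0 v) c \<le> r"
    and "t0 \<le> t" "v \<in> {1..N}"
  shows "circle_dist (acca N \<theta>0 \<xi> t v) c \<le> r"
  using assms(5,6)
proof (induction arbitrary: v rule: dec_induct)
  case (step t)
  show ?case
    using acca_step_circle_dist_le[OF assms(1) assms(2)[of t] assms(3) step.IH step.prems,
        where b = "snd (\<xi> t)"]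
    by simp
qed (rule ball)

text \<open>Vanishing energy alone would allow a common drift around the circle. Confinement to a
  ball about an earlier position of vertex 1 makes that vertex Cauchy, and the energy bounds the
  distance of the others to it.\<close>

lemma acca_consensus:
  assumes N: "2 \<le> N" and \<xi>: "\<And>t. fst (\<xi> t) \<in> {1..N}"
    and lim: "(\<lambda>t. energy N (acca N \<theta>0 \<xi> t)) \<longlonglongrightarrow> 0" and v: "v \<in> {1..N}"
  shows "circle_tendsto (\<lambda>t. acca N \<theta>0 \<xi> t v)
           (wrap_pi (lim (circle_lift (\<lambda>t. acca N \<theta>0 \<xi> t 1))))"
proof -
  let ?L = "wrap_pi (lim (circle_lift (\<lambda>t. acca N \<theta>0 \<xi> t 1)))"
  have "circle_tendsto (\<lambda>t. acca N \<theta>0 \<xi> t 1) ?L"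
  proof (rule circle_Cauchy_imp_tendsto)
    fix e :: real assume "0 < e"
    define r where "r = min e 1"
    have r: "0 < r" "r \<le> e" "r < pi / 2" using \<open>0 < e\<close> pi_gt3 by (auto simp: r_def)
    obtain t0 where "energy N (acca N \<theta>0 \<xi> t0) < r"
      using order_tendstoD(2)[OF lim r(1)] unfolding eventually_sequentially by blast
    then have "circle_dist (acca N \<theta>0 \<xi> t0 v) (acca N \<theta>0 \<xi> t0 1) \<le> r" if "v \<in> {1..N}" for v
      using circle_dist_le_energy[OF that, where \<theta> = "acca N \<theta>0 \<xi> t0"] by linarith
    then have "circle_dist (acca N \<theta>0 \<xi> t 1) (acca N \<theta>0 \<xi> t0 1) \<le> r" if "t0 \<le> t" for t
      using acca_circle_dist_le[where \<xi> = \<xi>, OF N \<xi> r(3) _ that] N by simp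
    then show "\<exists>t0. \<forall>t\<ge>t0. circle_dist (acca N \<theta>0 \<xi> t 1) (acca N \<theta>0 \<xi> t0 1) \<le> e"
      using r(2) by (meson order_trans)
  qed
  then have "(\<lambda>t. energy N (acca N \<theta>0 \<xi> t) + circle_dist (acca N \<theta>0 \<xi> t 1) ?L) \<longlonglongrightarrow> 0"
    unfolding circle_tendsto_def using tendsto_add[OF lim] by fastforce
  then show ?thesis
    unfolding circle_tendsto_def
  proof (rule tendsto_sandwich[OF _ _ tendsto_const, rotated 2])
    show "\<forall>\<^sub>F t in sequentially. circle_dist (acca N \<theta>0 \<xi> t v) ?L
        \<le> energy N (acca N \<theta>0 \<xi> t) + circle_dist (acca N \<theta>0 \<xi> t 1) ?L"
      using circle_dist_triangle circle_dist_le_energy[OF v]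
      by (intro always_eventually allI) (meson add_right_mono order_trans)
  qed simp
qed

lemma Max_edge_diff_tendsto_zero:
  assumes "1 \<le> N" and "(\<lambda>t. energy N (\<theta> t)) \<longlonglongrightarrow> 0"
  shows "(\<lambda>t. MAX i\<in>{1..N}. \<bar>edge_diff N (\<theta> t) i\<bar>) \<longlonglongrightarrow> 0"
  using assms(2)
proof (rule tendsto_sandwich[OF _ _ tendsto_const, rotated 2])
  have "(MAX i\<in>{1..N}. \<bar>edge_diff N (\<theta> t) i\<bar>) \<le> energy N (\<theta> t)" for t
    using assms(1) abs_edge_diff_le_energy by (subst Max_le_iff) auto
  then show "\<forall>\<^sub>F t in sequentially. (MAX i\<in>{1..N}. \<bar>edge_diff N (\<theta> t) i\<bar>) \<le> energy N (\<theta> t)"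
    by simp
  have "0 \<le> (MAX i\<in>{1..N}. \<bar>edge_diff N (\<theta> t) i\<bar>)" for t
    using assms(1) by (subst Max_ge_iff) auto
  then show "\<forall>\<^sub>F t in sequentially. 0 \<le> (MAX i\<in>{1..N}. \<bar>edge_diff N (\<theta> t) i\<bar>)"
    by simp
qed

section \<open>The random noise\<close>

text \<open>Disjoint blocks of length \<open>n\<close> are independent, and each matches the word
  with probability at least \<open>p ^ n\<close>; hence all of the first \<open>m\<close> blocks
  fail with probability at most \<open>(1 - p ^ n) ^ m\<close>.\<close>

lemma (in prob_space) AE_word_occurs:
  fixes X :: "nat \<Rightarrow> 'a \<Rightarrow> 'b"
  assumes ind: "indep_vars (\<lambda>_. count_space UNIV) X UNIV" and "0 < p"
    and p: "\<And>t j. p \<le> prob (X t -` A j \<inter> space M)"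
  shows "AE \<omega> in M. \<exists>t. \<forall>j<n. X (t + j) \<omega> \<in> A j"
proof (cases "n = 0")
  case n: False
  have X [measurable]: "X t \<in> measurable M (count_space UNIV)" for t
    using ind by (simp add: indep_vars_def)
  define K where "K m = {m * n..<m * n + n}" for m
  define Y where "Y m \<omega> = restrict (\<lambda>i. X i \<omega>) (K m)" for m \<omega>
  define P where "P m = PiM (K m) (\<lambda>_. count_space (UNIV :: 'b set))" for m
  \<comment> \<open>Failure is stated on the coordinate space of a block, so that
    \<open>Bad m\<close> is a preimage under \<open>Y m\<close> and inherits independence from the
    blocks.\<close>
  define B where "B m = {f \<in> space (P m). \<exists>j<n. f (m * n + j) \<notin> A j}" for m
  define Bad where "Bad m = {\<omega> \<in> space M. \<exists>j<n. X (m * n + j) \<omega> \<notin> A j}" for m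
  have "disjoint_family_on K UNIV"
    unfolding disjoint_family_on_def
  proof (intro ballI impI)
    fix m m' :: nat assume "m \<noteq> m'"
    have "m = i div n" if "i \<in> K m" for i m
      using that n by (auto simp: K_def intro!: div_nat_eqI[symmetric] simp: algebra_simps)
    then show "K m \<inter> K m' = {}" using \<open>m \<noteq> m'\<close> by blast
  qed
  then have indY: "indep_vars P Y UNIV"
    unfolding P_def Y_def by (intro indep_vars_restrict[OF ind]) auto
  have Bm: "B m \<in> sets (P m)" for m
  proof -
    have coord: "(\<lambda>f. f (m * n + j)) \<in> measurable (P m) (count_space UNIV)" if "j < n" for j
      unfolding P_def using that by (intro measurable_component_singleton) (simp add: K_def)
    have "B m = (\<Union>j\<in>{..<n}. (\<lambda>f. f (m * n + j)) -` (- A j) \<inter> space (P m))"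
      by (auto simp: B_def)
    also have "\<dots> \<in> sets (P m)"
      by (intro sets.finite_UN measurable_sets[OF coord]) auto
    finally show ?thesis .
  qed
  have Bad: "Bad m = Y m -` B m \<inter> space M" for m
    by (auto simp: Bad_def B_def Y_def P_def K_def space_PiM)
  have Bad_sets [measurable]: "Bad m \<in> events" for m
    unfolding Bad using indY Bm by (auto simp: indep_vars_def intro: measurable_sets)
  have Bad_le: "prob (Bad m) \<le> 1 - p ^ n" for m
  proof -
    let ?G = "\<Inter>j\<in>{..<n}. X (m * n + j) -` A j \<inter> space M"
    have "K m = (\<lambda>j. m * n + j) ` {..<n}"
      by (simp add: K_def lessThan_atLeast0 add.commute)
    then have "?G = (\<Inter>i\<in>K m. X i -` A (i - m * n) \<inter> space M)" by simp
    also have "prob \<dots> = (\<Prod>i\<in>K m. prob (X i -` A (i - m * n) \<inter> space M))"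
      using n by (intro indep_varsD[OF ind]) (auto simp: K_def)
    also have "\<dots> \<ge> (\<Prod>i\<in>K m. p)"
      using p \<open>0 < p\<close> by (intro prod_mono) auto
    finally have "p ^ n \<le> prob ?G" by (simp add: K_def)
    moreover have "Bad m = space M - ?G" using n by (auto simp: Bad_def)
    moreover have "?G \<in> events" using n by (intro sets.finite_INT) auto
    ultimately show ?thesis by (simp add: prob_compl)
  qed
  have "p \<le> 1" using p[of 0 0] prob_le_1 order_trans by blast
  then have q: "0 \<le> 1 - p ^ n" "1 - p ^ n < 1"
    using \<open>0 < p\<close> by (simp_all add: power_le_one)
  define Never where "Never = (\<Inter>m. Bad m)"
  have [measurable]: "Never \<in> events"
    unfolding Never_def by measurable
  have "prob Never \<le> (1 - p ^ n) ^ m" for m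
  proof (cases "m = 0")
    case False
    have "prob Never \<le> prob (\<Inter>i\<in>{..<m}. Bad i)"
      using False by (intro finite_measure_mono sets.finite_INT) (auto simp: Never_def)
    also have "\<dots> = (\<Prod>i\<in>{..<m}. prob (Bad i))"
      unfolding Bad using False Bm by (intro indep_varsD[OF indY]) auto
    also have "\<dots> \<le> (\<Prod>i\<in>{..<m}. 1 - p ^ n)"
      by (intro prod_mono) (auto simp: Bad_le)
    finally show ?thesis by simp
  qed simp
  then have "prob Never \<le> 0"
    using LIMSEQ_realpow_zero[OF q] by (intro LIMSEQ_le_const) auto
  then have "Never \<in> null_sets M"
    by (intro null_setsI) (auto simp: emeasure_eq_measure measure_le_0_iff)
  then have "AE \<omega> in M. \<omega> \<notin> Never" by (rule AE_not_in)
  then show ?thesis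
    by (rule AE_mp) (auto simp: Never_def Bad_def)
qed simp

section \<open>Marginals of the noise and measurability of the trajectory\<close>

lemma acca_noise_prob:
  assumes "acca_noise N M \<xi>" "1 \<le> N" "k \<in> {1..N}"
  shows "1 / real N \<le> measure M (\<xi> t -` {e. fst e = k} \<inter> space M)"
proof -
  interpret prob_space M using assms(1) by (simp add: acca_noise_def)
  have "\<xi> t \<in> measurable M (count_space UNIV)"
    using assms(1) by (simp add: acca_noise_def indep_vars_def)
  then have "measure M (\<xi> t -` {e. fst e = k} \<inter> space M)
      = measure (distr M (count_space UNIV) (\<xi> t)) {e. fst e = k}"
    by (simp add: measure_distr)
  also have "\<dots> = measure (measure_pmf (pair_pmf (pmf_of_set {1..N}) (bernoulli_pmf (1 / 2))))
      (fst -` {k})"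
    using assms(1) by (simp add: acca_noise_def vimage_def)
  also have "\<dots> = measure (measure_pmf (map_pmf fst
      (pair_pmf (pmf_of_set {1..N}) (bernoulli_pmf (1 / 2))))) {k}"
    by simp
  also have "\<dots> = 1 / real N"
    using assms(2,3) by (simp add: map_fst_pair_pmf measure_pmf_single pmf_of_set)
  finally show ?thesis by simp
qed

text \<open>Only the law of the noise is prescribed, so invalid edges may occur on a null set; the
  trajectory lemmas require valid edges at all times.\<close>

lemma acca_noise_AE_edge:
  assumes "acca_noise N M \<xi>" "1 \<le> N"
  shows "AE \<omega> in M. \<forall>t. fst (\<xi> t \<omega>) \<in> {1..N}"
  unfolding AE_all_countable
proof
  fix t
  interpret prob_space M using assms(1) by (simp add: acca_noise_def)
  have rv: "\<xi> t \<in> measurable M (count_space UNIV)"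
    using assms(1) by (simp add: acca_noise_def indep_vars_def)
  have "AE e in distr M (count_space UNIV) (\<xi> t). fst e \<in> {1..N}"
  proof -
    have "distr M (count_space UNIV) (\<xi> t)
        = measure_pmf (pair_pmf (pmf_of_set {1..N}) (bernoulli_pmf (1 / 2)))"
      using assms(1) by (simp add: acca_noise_def)
    then show ?thesis
      using assms(2) by (simp only: AE_measure_pmf_iff) auto
  qed
  then show "AE \<omega> in M. fst (\<xi> t \<omega>) \<in> {1..N}"
    by (rule AE_distrD[OF rv])
qed

text \<open>Edge and coin take countably many values, so it is enough to treat a step with both
  fixed.\<close>

lemma acca_borel_measurable:
  assumes [measurable]: "\<And>t. \<xi> t \<in> measurable M (count_space UNIV)"
  shows "(\<lambda>\<omega>. acca N \<theta>0 (\<lambda>s. \<xi> s \<omega>) t v) \<in> borel_measurable M"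
proof (induction t arbitrary: v)
  case (Suc t)
  have "(\<lambda>\<omega>. acca_step N e (acca N \<theta>0 (\<lambda>s. \<xi> s \<omega>) t) v) \<in> borel_measurable M" for e
  proof -
    obtain k b where "e = (k, b)" by fastforce
    note [measurable] = Suc.IH
    show ?thesis
      unfolding \<open>e = (k, b)\<close> acca_step_def edge_diff_def Let_def prod.case
        if_distrib[where f = "\<lambda>f. f v"] fun_upd_apply
      by measurable
  qed
  then show ?case
    unfolding acca.simps by (rule measurable_compose_countable) measurable
qed simp

theorem proposition3p2:
  fixes N :: nat and \<theta>0 :: config and M :: "'w measure"
    and \<xi> :: "nat \<Rightarrow> 'w \<Rightarrow> nat \<times> bool" and \<theta> :: "nat \<Rightarrow> 'w \<Rightarrow> config"
  assumes "N \<ge> 2"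
    and "\<forall>i\<in>{1..N}. \<theta>0 i \<in> {-pi..<pi}"
    and "acca_noise N M \<xi>"
    and "\<And>t \<omega>. \<theta> t \<omega> = acca N \<theta>0 (\<lambda>s. \<xi> s \<omega>) t"
  shows "(AE \<omega> in M. (\<lambda>t. MAX i\<in>{1..N}. \<bar>edge_diff N (\<theta> t \<omega>) i\<bar>) \<longlonglongrightarrow> 0)
         \<and> strong_consensus_as N M \<theta>"
proof -
  interpret prob_space M using assms(3) by (simp add: acca_noise_def)
  have N: "2 \<le> N" "1 \<le> N" using assms(1) by simp_all
  have ind: "indep_vars (\<lambda>_. count_space UNIV) \<xi> UNIV"
    using assms(3) by (simp add: acca_noise_def)
  have [measurable]: "\<xi> t \<in> measurable M (count_space UNIV)" for t
    using ind by (simp add: indep_vars_def)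
  \<comment> \<open>The word is the sweep \<open>1, ..., N - 1\<close> repeated \<open>R\<close>
    times; the exceptional null sets are then united over the countably many
    \<open>R\<close>.\<close>
  have "AE \<omega> in M. \<exists>t. \<forall>j<R * (N - 1). \<xi> (t + j) \<omega> \<in> {e. fst e = Suc (j mod (N - 1))}" for R
  proof (rule AE_word_occurs[OF ind])
    show "0 < 1 / real N" using N by simp
    fix t j
    have "j mod (N - 1) < N - 1" using N by (intro mod_less_divisor) simp
    then have "Suc (j mod (N - 1)) \<in> {1..N}" by auto
    then show "1 / real N \<le> prob (\<xi> t -` {e. fst e = Suc (j mod (N - 1))} \<inter> space M)"
      by (rule acca_noise_prob[OF assms(3) N(2)])
  qed
  then have "AE \<omega> in M. \<forall>R. \<exists>t. \<forall>j<R * (N - 1). fst (\<xi> (t + j) \<omega>) = Suc (j mod (N - 1))"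
    by (simp add: AE_all_countable)
  with acca_noise_AE_edge[OF assms(3) N(2)]
  have good: "AE \<omega> in M. (\<forall>t. fst (\<xi> t \<omega>) \<in> {1..N})
      \<and> (\<lambda>t. energy N (\<theta> t \<omega>)) \<longlonglongrightarrow> 0"
    by eventually_elim (use energy_acca_tendsto_zero[OF N(1)] in \<open>simp add: assms(4)\<close>)
  \<comment> \<open>\<open>lim\<close> is total, so \<open>L\<close> is defined at every outcome,
    and the outer \<open>wrap_pi\<close> keeps it in the circle even where the lift
    diverges.\<close>
  define L where "L \<omega> = wrap_pi (lim (circle_lift (\<lambda>t. \<theta> t \<omega> 1)))" for \<omega>
  have [measurable]: "(\<lambda>\<omega>. \<theta> t \<omega> v) \<in> borel_measurable M" for t v
    unfolding assms(4) by (rule acca_borel_measurable) measurable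
  have "L \<in> borel_measurable M"
    unfolding L_def circle_lift_def by measurable
  moreover have "\<forall>\<omega>\<in>space M. L \<omega> \<in> {-pi..<pi}"
    by (simp add: L_def wrap_pi_ge wrap_pi_less)
  moreover have "AE \<omega> in M. \<forall>v\<in>{1..N}. circle_tendsto (\<lambda>t. \<theta> t \<omega> v) (L \<omega>)"
    using good
    by eventually_elim (use acca_consensus[OF N(1)] in \<open>simp add: assms(4) L_def\<close>)
  ultimately have "strong_consensus_as N M \<theta>"
    unfolding strong_consensus_as_def by blast
  moreover have "AE \<omega> in M. (\<lambda>t. MAX i\<in>{1..N}. \<bar>edge_diff N (\<theta> t \<omega>) i\<bar>) \<longlonglongrightarrow> 0"
    using good by eventually_elim (rule Max_edge_diff_tendsto_zero[OF N(2)], rule conjunct2)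
  ultimately show ?thesis by blast
qed

end
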